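(* Let $n\geq1$ and fix a set $D\subset S^{n-1}\subset\mathbb{R}^n$. Consider the X-ray transform $f\mapsto(R_vf)_{v\in D}$ on the space $C_0^\infty(\mathbb{R}^n)$ with directions in the set $D$, where $R_vf(x)=\int_{\mathbb{R}}f(x+tv)\,\mathrm{d}t$, and let $N(D)=\{x\in\mathbb{R}^n : x\cdot v=0\text{ for some }v\in D\}$. (1) If $D$ is finite, the transform is not injective. (2) If $N(D)$ has an interior point, then the transform is injective. In particular, either of the following suffices for injectivity: (a) $D$ is nonempty and open. (b) $D$ contains a connected set of at least two points.
   Context: $C_0^\infty(\mathbb{R}^n)$ is the space of compactly supported smooth complex-valued functions on $\mathbb{R}^n$. $S^{n-1}$ is the unit sphere of $\mathbb{R}^n$; openness of $D$ is as a subset of $S^{n-1}$, and interior points of $N(D)$ are taken in $\mathbb{R}^n$. Injectivity means: if $f\in C_0^\infty(\mathbb{R}^n)$ and $R_vf=0$ identically for all $v\in D$, then $f=0$.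
   Formalization: Part (2)(a) is stated for n ≥ 2 only: for n = 1 it is false, since D = {1} is nonempty and open in S^0 while R_1 f is the integral of f, which vanishes for many nonzero f. *)

theory Defs
  imports "HOL-Analysis.Analysis"
begin

text \<open>\<open>C_k k f\<close>: \<open>f\<close> is \<open>k\<close> times continuously differentiable on the whole space. Iterating the
  directional derivatives \<open>\<lambda>x. frechet_derivative f (at x) v\<close> keeps the codomain type fixed; in finite
  dimension this agrees with continuity of the \<open>k\<close>-th Frechet derivative.\<close>

primrec C_k :: "nat \<Rightarrow> ('a::real_normed_vector \<Rightarrow> 'b::real_normed_vector) \<Rightarrow> bool" where
  "C_k 0 f \<longleftrightarrow> continuous_on UNIV f"
| "C_k (Suc k) f \<longleftrightarrow> (\<forall>x. f differentiable (at x)) \<and>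
     (\<forall>v. C_k k (\<lambda>x. frechet_derivative f (at x) v))"

definition smooth :: "('a::real_normed_vector \<Rightarrow> 'b::real_normed_vector) \<Rightarrow> bool" where
  "smooth f \<longleftrightarrow> (\<forall>k. C_k k f)"

definition C0_infty :: "(real ^ 'n \<Rightarrow> complex) set" where
  "C0_infty = {f. smooth f \<and> compact (closure (support_on UNIV f))}"

definition xray :: "real ^ 'n \<Rightarrow> (real ^ 'n \<Rightarrow> complex) \<Rightarrow> real ^ 'n \<Rightarrow> complex" where
  "xray v f x = (LINT t|lborel. f (x + t *\<^sub>R v))"

text \<open>The transform is linear on \<open>C0_infty\<close>, so injectivity is expressed as triviality of the
  kernel.\<close>

definition xray_injective :: "(real ^ 'n) set \<Rightarrow> bool" where
  "xray_injective D \<longleftrightarrow>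
     (\<forall>f\<in>C0_infty. (\<forall>v\<in>D. \<forall>x. xray v f x = 0) \<longrightarrow> f = (\<lambda>_. 0))"

definition normal_set :: "(real ^ 'n) set \<Rightarrow> (real ^ 'n) set" where
  "normal_set D = {x. \<exists>v\<in>D. x \<bullet> v = 0}"

end

theory Submission
  imports Defs
begin

text \<open>If \<open>R\<^sub>v f = 0\<close> for a unit vector \<open>v\<close> orthogonal to \<open>\<xi>\<close>, integrating first along \<open>v\<close> shows
  that \<open>f\<close> is orthogonal to every function of \<open>y \<bullet> \<xi>\<close>. Hence the moments \<open>\<integral> f(y) (y \<bullet> \<xi>)\<^sup>k dy\<close> vanish for
  \<open>\<xi> \<in> N(D)\<close>. They are polynomials in \<open>\<xi>\<close>, so if \<open>N(D)\<close> has an interior point they vanish for all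
  \<open>\<xi>\<close>; summing the exponential series, \<open>f\<close> is orthogonal to all \<open>exp (y \<bullet> \<xi>)\<close>, and \<open>f = 0\<close> by
  Stone-Weierstrass.
  If \<open>u, v\<close> are distinct points of a connected \<open>C \<subseteq> D\<close>, then \<open>N(D)\<close> contains the nonempty open set
  \<open>{x. x \<bullet> u < 0 < x \<bullet> v}\<close>, since \<open>x \<bullet> _\<close> vanishes somewhere on \<open>C\<close>.
  For finite \<open>D\<close>, applying the differences \<open>f \<mapsto> f(\<cdot> + v) - f\<close> for all \<open>v \<in> D\<close> to a bump function yields
  an element of the kernel; no difference annihilates a nonzero function of compact support.\<close>

section \<open>Integrability of functions with bounded support\<close>

lemma bounded_if_compact_support:
  fixes h :: "'a::euclidean_space \<Rightarrow> 'b::real_normed_vector"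
  assumes "continuous_on UNIV h" and "\<And>y. h y \<noteq> 0 \<Longrightarrow> norm y \<le> M"
  obtains C where "\<And>y. norm (h y) \<le> C"
proof -
  have "compact (h ` cball 0 M)"
    using assms(1) by (intro compact_continuous_image) (auto intro: continuous_on_subset)
  then obtain B where B: "\<And>y. y \<in> cball 0 M \<Longrightarrow> norm (h y) \<le> B"
    by (meson bounded_iff compact_imp_bounded imageI)
  \<comment> \<open>For \<open>M < 0\<close> the ball is empty and \<open>B\<close> may be negative,
    hence the maximum with \<open>0\<close>.\<close>
  have "norm (h y) \<le> max B 0" for y
    using B[of y] assms(2)[of y] by (cases "h y = 0") (auto simp: le_max_iff_disj)
  then show thesis
    by (rule that)
qed

text \<open>Formulated for measurable functions so that it also covers integrands with an indicator
  factor.\<close>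

lemma integrable_bounded_support:
  fixes h :: "'a::euclidean_space \<Rightarrow> 'b::{banach, second_countable_topology}"
  assumes "h \<in> borel_measurable borel" "\<And>y. norm (h y) \<le> C" "\<And>y. h y \<noteq> 0 \<Longrightarrow> norm y \<le> M"
  shows "integrable lborel h"
proof (rule integrableI_bounded_set[where A = "cball 0 M" and B = C])
  show "emeasure lborel (cball (0::'a) M) < \<infinity>"
    by (rule emeasure_lborel_cball_finite)
qed (use assms in auto)

lemma integrable_compact_support:
  fixes h :: "'a::euclidean_space \<Rightarrow> 'b::{banach, second_countable_topology}"
  assumes "continuous_on UNIV h" "\<And>y. h y \<noteq> 0 \<Longrightarrow> norm y \<le> M"
  shows "integrable lborel h"
proof -
  obtain C where "\<And>y. norm (h y) \<le> C"
    using bounded_if_compact_support[OF assms] by blast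
  then show ?thesis
    using assms by (intro integrable_bounded_support[of h C M] borel_measurable_continuous_onI)
qed

lemma integrable_line:
  fixes f :: "'a::euclidean_space \<Rightarrow> 'b::{banach, second_countable_topology}"
  assumes "continuous_on UNIV f" "\<And>y. f y \<noteq> 0 \<Longrightarrow> norm y \<le> M" "norm v = 1"
  shows "integrable lborel (\<lambda>t. f (x + t *\<^sub>R v))"
proof (rule integrable_compact_support)
  show "continuous_on UNIV (\<lambda>t. f (x + t *\<^sub>R v))"
    by (intro continuous_on_compose2[OF assms(1)] continuous_intros) auto
  show "norm t \<le> M + norm x" if "f (x + t *\<^sub>R v) \<noteq> 0" for t
    using norm_triangle_ineq2[of "t *\<^sub>R v" "- x"] assms(2)[OF that] assms(3)
    by (simp add: add.commute)
qed

section \<open>From line integrals to ridge functions\<close>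

lemma lborel_integral_translate:
  fixes f :: "'a::euclidean_space \<Rightarrow> 'b::{banach, second_countable_topology}"
  assumes "f \<in> borel_measurable borel"
  shows "(LINT y|lborel. f (y + c)) = (LINT y|lborel. f y)"
proof -
  have "(LINT y|lborel. f y) = (LINT y|distr lborel borel ((+) c). f y)"
    by (simp add: lborel_distr_plus)
  also have "\<dots> = (LINT y|lborel. f (c + y))"
    using assms by (intro integral_distr) auto
  finally show ?thesis
    by (simp add: add.commute)
qed

text \<open>Inserting the weight \<open>indicator {0..1} (y \<bullet> v - t)\<close>, which integrates to \<open>1\<close> over \<open>t\<close>,
  gives an integrand on \<open>'a \<times> real\<close> of bounded support; the shift \<open>y = z + t v\<close> leaves the ridge
  function alone and turns the inner integral into a line integral of \<open>g\<close>.\<close>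

lemma integral_ridge_zero:
  fixes g :: "'a::euclidean_space \<Rightarrow> real"
  assumes g: "continuous_on UNIV g" "\<And>y. g y \<noteq> 0 \<Longrightarrow> norm y \<le> M" and v: "norm v = 1"
    and line: "\<And>x. (LINT t|lborel. g (x + t *\<^sub>R v)) = 0"
    and \<phi>: "continuous_on UNIV \<phi>" and \<xi>: "\<xi> \<bullet> v = 0"
  shows "(LINT y|lborel. g y * \<phi> (y \<bullet> \<xi>)) = 0"
proof -
  define h where "h y = g y * \<phi> (y \<bullet> \<xi>)" for y
  define \<psi> :: "real \<Rightarrow> real" where "\<psi> = indicator {0..1}"
  have \<psi>_meas [measurable]: "\<psi> \<in> borel_measurable borel"
    unfolding \<psi>_def by measurable
  have h: "continuous_on UNIV h"
    unfolding h_def by (intro continuous_intros g continuous_on_compose2[OF \<phi>]) auto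
  have [measurable]: "h \<in> borel_measurable borel"
    using h by (rule borel_measurable_continuous_onI)
  have supp: "norm y \<le> M" if "h y \<noteq> 0" for y
    using that g(2) by (auto simp: h_def)
  obtain C where C: "\<And>y. norm (h y) \<le> C"
    using bounded_if_compact_support[OF h supp] by blast
  have C': "norm (h y * \<psi> s) \<le> C" for y s
    using C[of y] by (auto simp: \<psi>_def indicator_def intro: order_trans[OF norm_ge_zero])
  have inner_le: "\<bar>y \<bullet> v\<bar> \<le> norm y" for y
    using Cauchy_Schwarz_ineq2[of y v] v by simp
  have vv: "v \<bullet> v = 1"
    using v by (simp add: norm_eq_sqrt_inner)
  have int1: "integrable (lborel \<Otimes>\<^sub>M lborel) (\<lambda>(y, t). h y * \<psi> (y \<bullet> v - t))"
    unfolding lborel_prod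
  \<comment> \<open>On the support \<open>norm y \<le> M\<close>, and \<open>t\<close> lies within
    distance 1 of \<open>y \<bullet> v\<close>, so \<open>\<bar>t\<bar> \<le> M + 1\<close>.\<close>
  proof (rule integrable_bounded_support[where C = C and M = "M + (M + 1)"])
    show "(\<lambda>(y, t). h y * \<psi> (y \<bullet> v - t)) \<in> borel_measurable borel"
      unfolding borel_prod[symmetric] by measurable
    show "norm z \<le> M + (M + 1)" if "(\<lambda>(y, t). h y * \<psi> (y \<bullet> v - t)) z \<noteq> 0" for z
    proof -
      obtain y t where z: "z = (y, t)" by (cases z)
      have "norm y \<le> M" "0 \<le> y \<bullet> v - t" "y \<bullet> v - t \<le> 1"
        using that supp[of y] by (auto simp: z \<psi>_def indicator_def split: if_splits)
      then have "norm y \<le> M" "norm t \<le> M + 1"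
        using inner_le[of y] by (auto simp: abs_le_iff)
      then show ?thesis
        using norm_Pair_le[of y t] by (simp add: z)
    qed
  qed (use C' in auto)
  have int2: "integrable (lborel \<Otimes>\<^sub>M lborel) (\<lambda>(z, t). h (z + t *\<^sub>R v) * \<psi> (z \<bullet> v))"
    unfolding lborel_prod
  \<comment> \<open>Here \<open>t\<close> is the difference of
    \<open>(z + t *\<^sub>R v) \<bullet> v\<close> and \<open>z \<bullet> v\<close>, so again
    \<open>\<bar>t\<bar> \<le> M + 1\<close>. Subtracting \<open>t *\<^sub>R v\<close> from a point
    of norm at most \<open>M\<close> then gives \<open>norm z \<le> M + (M + 1)\<close>.\<close>
  proof (rule integrable_bounded_support[where C = C and M = "(M + (M + 1)) + (M + 1)"])
    show "(\<lambda>(z, t). h (z + t *\<^sub>R v) * \<psi> (z \<bullet> v)) \<in> borel_measurable borel"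
      unfolding borel_prod[symmetric] by measurable
    show "norm w \<le> (M + (M + 1)) + (M + 1)"
      if "(\<lambda>(z, t). h (z + t *\<^sub>R v) * \<psi> (z \<bullet> v)) w \<noteq> 0" for w
    proof -
      obtain z t where w: "w = (z, t)" by (cases w)
      have *: "norm (z + t *\<^sub>R v) \<le> M" "0 \<le> z \<bullet> v" "z \<bullet> v \<le> 1"
        using that supp[of "z + t *\<^sub>R v"] by (auto simp: w \<psi>_def indicator_def split: if_splits)
      then have t: "norm t \<le> M + 1"
        using inner_le[of "z + t *\<^sub>R v"] vv by (auto simp: inner_add_left abs_le_iff)
      moreover have "norm z \<le> M + (M + 1)"
        using norm_triangle_ineq2[of z "- (t *\<^sub>R v)"] * t v by simp
      ultimately show ?thesis
        using norm_Pair_le[of z t] by (simp add: w)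
    qed
  qed (use C' in auto)
  have \<psi>1: "(LINT t|lborel. \<psi> (c - t)) = 1" for c
  proof -
    have "(\<lambda>t. \<psi> (c - t)) = indicator {c - 1..c}"
      by (auto simp: \<psi>_def indicator_def fun_eq_iff)
    then show ?thesis by simp
  qed
  have "(LINT y|lborel. h y) = (LINT y|lborel. LINT t|lborel. h y * \<psi> (y \<bullet> v - t))"
    by (simp add: \<psi>1)
  also have "\<dots> = (LINT t|lborel. LINT y|lborel. h y * \<psi> (y \<bullet> v - t))"
    using lborel_pair.Fubini_integral[OF int1] by simp
  also have "\<dots> = (LINT t|lborel. LINT z|lborel. h (z + t *\<^sub>R v) * \<psi> (z \<bullet> v))"
  proof (rule Bochner_Integration.integral_cong)
    fix t
    have "(LINT y|lborel. h y * \<psi> (y \<bullet> v - t)) =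
      (LINT z|lborel. h (z + t *\<^sub>R v) * \<psi> ((z + t *\<^sub>R v) \<bullet> v - t))"
      by (rule lborel_integral_translate[symmetric]) measurable
    then show "(LINT y|lborel. h y * \<psi> (y \<bullet> v - t)) = (LINT z|lborel. h (z + t *\<^sub>R v) * \<psi> (z \<bullet> v))"
      by (simp add: inner_add_left vv)
  qed simp
  also have "\<dots> = (LINT z|lborel. LINT t|lborel. h (z + t *\<^sub>R v) * \<psi> (z \<bullet> v))"
    using lborel_pair.Fubini_integral[OF int2] by simp
  \<comment> \<open>Since \<open>\<xi> \<bullet> v = 0\<close>, the ridge factor is constant in
    \<open>t\<close>; both it and the weight leave the inner integral, which is a line integral of
    \<open>g\<close>.\<close>
  also have "\<dots> = (LINT z|lborel. LINT t|lborel. g (z + t *\<^sub>R v) * (\<phi> (z \<bullet> \<xi>) * \<psi> (z \<bullet> v)))"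
    using \<xi> by (simp add: h_def inner_add_left inner_commute[of v] mult.assoc)
  also have "\<dots> = 0"
    by (simp add: line)
  finally show ?thesis
    by (simp add: h_def)
qed

section \<open>Moments and exponential integrals\<close>

text \<open>On the line from an interior point \<open>\<xi>0\<close> of \<open>N\<close> to
  \<open>\<xi>\<close>, the moment is a polynomial in the line parameter \<open>t\<close>. It
  vanishes for all small \<open>t\<close>, so it has infinitely many roots and all its coefficients
  are zero; \<open>t = 1\<close> gives the claim.\<close>

lemma moments_zero_extend:
  fixes g :: "'a::euclidean_space \<Rightarrow> real"
  assumes g: "continuous_on UNIV g" "\<And>y. g y \<noteq> 0 \<Longrightarrow> norm y \<le> M"
    and zero: "\<And>\<xi>. \<xi> \<in> N \<Longrightarrow> (LINT y|lborel. g y * (y \<bullet> \<xi>) ^ k) = 0" and N: "interior N \<noteq> {}"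
  shows "(LINT y|lborel. g y * (y \<bullet> \<xi>) ^ k) = 0"
proof -
  obtain \<xi>0 e where e: "e > 0" "ball \<xi>0 e \<subseteq> N"
    using N by (auto simp: mem_interior)
  define \<eta> where "\<eta> = \<xi> - \<xi>0"
  define c where "c j = (LINT y|lborel. g y * (of_nat (k choose j) * (y \<bullet> \<eta>) ^ j * (y \<bullet> \<xi>0) ^ (k - j)))" for j
  have int: "integrable lborel (\<lambda>y. g y * (of_nat (k choose j) * (y \<bullet> \<eta>) ^ j * (y \<bullet> \<xi>0) ^ (k - j)))" for j
    by (rule integrable_compact_support[where M = M]) (use g in \<open>auto intro!: continuous_intros\<close>)
  have expand: "(LINT y|lborel. g y * (y \<bullet> (\<xi>0 + t *\<^sub>R \<eta>)) ^ k) = (\<Sum>j\<le>k. c j * t ^ j)" for t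
  proof -
    have "g y * (y \<bullet> (\<xi>0 + t *\<^sub>R \<eta>)) ^ k =
        (\<Sum>j\<le>k. g y * (of_nat (k choose j) * (y \<bullet> \<eta>) ^ j * (y \<bullet> \<xi>0) ^ (k - j)) * t ^ j)" for y
    proof -
      have "y \<bullet> (\<xi>0 + t *\<^sub>R \<eta>) = t * (y \<bullet> \<eta>) + y \<bullet> \<xi>0"
        by (simp add: inner_add_right)
      then show ?thesis
        by (simp only: binomial_ring sum_distrib_left) (simp add: power_mult_distrib algebra_simps)
    qed
    then show ?thesis
      unfolding c_def using int by (simp add: Bochner_Integration.integral_sum)
  qed
  \<comment> \<open>The bound ensures \<open>\<bar>t\<bar> * norm \<eta> < e\<close>, so the point
    stays in the ball; adding 1 to the denominator covers \<open>\<eta> = 0\<close>.\<close>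
  have roots: "{-e / (norm \<eta> + 1)<..<e / (norm \<eta> + 1)} \<subseteq> {t. (\<Sum>j\<le>k. c j * t ^ j) = 0}"
  proof
    fix t assume "t \<in> {-e / (norm \<eta> + 1)<..<e / (norm \<eta> + 1)}"
    then have "\<bar>t\<bar> < e / (norm \<eta> + 1)"
      by (auto simp: abs_less_iff)
    then have "\<bar>t\<bar> * (norm \<eta> + 1) < e"
      by (subst (asm) pos_less_divide_eq) (auto simp: add_nonneg_pos)
    then have "\<bar>t\<bar> * norm \<eta> < e"
      by (simp add: distrib_left)
    then have "\<xi>0 + t *\<^sub>R \<eta> \<in> ball \<xi>0 e"
      by (simp add: dist_norm)
    then show "t \<in> {t. (\<Sum>j\<le>k. c j * t ^ j) = 0}"
      using e(2) zero by (auto simp flip: expand)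
  qed
  have "- e / (norm \<eta> + 1) < 0" "0 < e / (norm \<eta> + 1)"
    using e(1) by (auto simp: divide_less_0_iff add_nonneg_pos)
  then have "- e / (norm \<eta> + 1) < e / (norm \<eta> + 1)"
    by linarith
  then have "infinite {t. (\<Sum>j\<le>k. c j * t ^ j) = 0}"
    using roots finite_subset infinite_Ioo by blast
  then have "\<forall>j\<le>k. c j = 0"
    using polyfun_finite_roots[of c k] by blast
  then show ?thesis
    using expand[of 1] by (simp add: \<eta>_def)
qed

text \<open>Termwise integration of the exponential series is justified by the bound
  \<open>\<bar>y \<bullet> \<xi>\<bar> \<le> M * norm \<xi>\<close> on the support of
  \<open>g\<close>: the integrals of the norms are dominated by the series of
  \<open>exp (M * norm \<xi>)\<close>, scaled by the L1 norm of \<open>g\<close>.\<close>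

lemma integral_exp_zero:
  fixes g :: "'a::euclidean_space \<Rightarrow> real"
  assumes g: "continuous_on UNIV g" "\<And>y. g y \<noteq> 0 \<Longrightarrow> norm y \<le> M"
    and zero: "\<And>k. (LINT y|lborel. g y * (y \<bullet> \<xi>) ^ k) = 0"
  shows "(LINT y|lborel. g y * exp (y \<bullet> \<xi>)) = 0"
proof -
  define F where "F k y = g y * ((y \<bullet> \<xi>) ^ k /\<^sub>R fact k)" for k y
  have F_sums: "(\<lambda>k. F k y) sums (g y * exp (y \<bullet> \<xi>))" for y
    unfolding F_def by (intro sums_mult exp_converges)
  have int: "integrable lborel (F k)" for k
    unfolding F_def
    by (rule integrable_compact_support[where M = M]) (use g in \<open>auto intro!: continuous_intros\<close>)
  have int_g: "integrable lborel g"
    using g by (rule integrable_compact_support)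
  have "(\<lambda>k. LINT y|lborel. F k y) sums (LINT y|lborel. (\<Sum>k. F k y))"
  proof (rule sums_integral[OF int])
    have "summable (\<lambda>k. norm (F k y))" for y
      unfolding F_def norm_mult using summable_norm_exp[of "y \<bullet> \<xi>"] by (rule summable_mult)
    then show "AE y in lborel. summable (\<lambda>k. norm (F k y))"
      by simp
    have le: "(LINT y|lborel. norm (F k y)) \<le> (LINT y|lborel. norm (g y)) * ((M * norm \<xi>) ^ k /\<^sub>R fact k)" for k
    proof -
      have "norm (F k y) \<le> norm (g y) * ((M * norm \<xi>) ^ k /\<^sub>R fact k)" for y
      proof (cases "g y = 0")
        case False
        have "\<bar>y \<bullet> \<xi>\<bar> \<le> M * norm \<xi>"
          using Cauchy_Schwarz_ineq2[of y \<xi>] g(2)[OF False]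
          by (meson mult_right_mono norm_ge_zero order_trans)
        then have "\<bar>y \<bullet> \<xi>\<bar> ^ k \<le> (M * norm \<xi>) ^ k"
          by (intro power_mono) auto
        then show ?thesis
          unfolding F_def
          by (auto simp: abs_mult power_abs intro!: mult_left_mono)
      qed (simp add: F_def)
      then have "(LINT y|lborel. norm (F k y)) \<le> (LINT y|lborel. norm (g y) * ((M * norm \<xi>) ^ k /\<^sub>R fact k))"
        using int int_g by (intro integral_mono) auto
      then show ?thesis by simp
    qed
    show "summable (\<lambda>k. LINT y|lborel. norm (F k y))"
    proof (rule summable_comparison_test)
      show "\<exists>N. \<forall>k\<ge>N. norm (LINT y|lborel. norm (F k y)) \<le> (LINT y|lborel. norm (g y)) * ((M * norm \<xi>) ^ k /\<^sub>R fact k)"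
        using le by (auto simp: abs_of_nonneg)
      show "summable (\<lambda>k. (LINT y|lborel. norm (g y)) * ((M * norm \<xi>) ^ k /\<^sub>R fact k))"
        by (intro summable_mult summable_exp_generic)
    qed
  qed
  moreover have "(LINT y|lborel. F k y) = 0" for k
  proof -
    have "F k = (\<lambda>y. (g y * (y \<bullet> \<xi>) ^ k) * inverse (fact k))"
      by (simp add: F_def fun_eq_iff)
    then show ?thesis
      by (simp add: zero)
  qed
  ultimately show ?thesis
    using F_sums by (simp add: sums_iff)
qed

section \<open>Density of exponentials\<close>

inductive_set exp_algebra :: "('a::real_inner \<Rightarrow> real) set" where
  exp: "(\<lambda>y. c * exp (y \<bullet> \<xi>)) \<in> exp_algebra"
| add: "p \<in> exp_algebra \<Longrightarrow> q \<in> exp_algebra \<Longrightarrow> (\<lambda>y. p y + q y) \<in> exp_algebra"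

text \<open>Exponents add, so a product of two generators is again a generator; distributivity
  extends this to sums in each factor.\<close>

lemma exp_algebra_mult:
  assumes "p \<in> exp_algebra" "q \<in> exp_algebra"
  shows "(\<lambda>y. p y * q y) \<in> exp_algebra"
  using assms(1)
proof induction
  case (exp c \<xi>)
  show ?case
    using assms(2)
  proof induction
    case (exp d \<eta>)
    have "(\<lambda>y. c * exp (y \<bullet> \<xi>) * (d * exp (y \<bullet> \<eta>))) = (\<lambda>y. c * d * exp (y \<bullet> (\<xi> + \<eta>)))"
      by (simp add: inner_add_right exp_add mult_ac)
    then show ?case
      by (simp only: exp_algebra.exp)
  next
    case (add p q)
    then show ?case
      using exp_algebra.add by (fastforce simp: distrib_left)
  qed
next
  case (add p q)
  then show ?case
    using exp_algebra.add by (fastforce simp: distrib_right)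
qed

lemma exp_algebra_continuous: "p \<in> exp_algebra \<Longrightarrow> continuous_on S p"
  by (induction rule: exp_algebra.induct) (auto intro!: continuous_intros)

lemma function_ring_on_exp_algebra:
  fixes S :: "'a::real_inner set"
  assumes "compact S"
  shows "function_ring_on exp_algebra S"
proof
  show "(\<lambda>_::'a. c) \<in> exp_algebra" for c
    using exp_algebra.exp[of c 0] by simp
  show "\<exists>p\<in>exp_algebra. p x \<noteq> p y" if "x \<noteq> y" for x y :: 'a
  proof -
    \<comment> \<open>The exponential in direction \<open>x - y\<close> separates \<open>x\<close>
      from \<open>y\<close>.\<close>
    have "(x - y) \<bullet> (x - y) \<noteq> 0"
      using that by simp
    then have "x \<bullet> (x - y) \<noteq> y \<bullet> (x - y)"
      by (metis inner_diff_left right_minus_eq)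
    then show ?thesis
      using exp_algebra.exp[of 1 "x - y"] by (intro bexI[of _ "\<lambda>z. 1 * exp (z \<bullet> (x - y))"]) auto
  qed
qed (use assms exp_algebra_continuous exp_algebra.add exp_algebra_mult in auto)

text \<open>For \<open>p\<close> in \<open>exp_algebra\<close> the integral of \<open>g * g\<close>
  equals that of \<open>g * (g - p)\<close>. This is arbitrarily small, because \<open>p\<close> can
  approximate \<open>g\<close> uniformly on a ball carrying the support of \<open>g\<close>.\<close>

lemma zero_if_exp_integrals_zero:
  fixes g :: "'a::euclidean_space \<Rightarrow> real"
  assumes g: "continuous_on UNIV g" "\<And>y. g y \<noteq> 0 \<Longrightarrow> norm y \<le> M"
    and zero: "\<And>\<xi>. (LINT y|lborel. g y * exp (y \<bullet> \<xi>)) = 0"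
  shows "g y = 0"
proof -
  have int: "integrable lborel (\<lambda>y. g y * p y)" if "continuous_on UNIV p" for p
    by (rule integrable_compact_support[where M = M]) (use g that in \<open>auto intro!: continuous_intros\<close>)
  have int_g: "integrable lborel g"
    using g by (rule integrable_compact_support)
  have exp_zero: "(LINT y|lborel. g y * p y) = 0" if "p \<in> exp_algebra" for p
    using that
  proof induction
    case (exp c \<xi>)
    show ?case
      using zero[of \<xi>] by (simp add: mult.left_commute[of "g _"])
  next
    case (add p q)
    then show ?case
      using int[OF exp_algebra_continuous[OF add.hyps(1)]] int[OF exp_algebra_continuous[OF add.hyps(2)]]
      by (simp add: distrib_left)
  qed
  define I where "I = (LINT y|lborel. norm (g y))"
  have I: "I \<ge> 0"
    by (simp add: I_def)
  have "(LINT y|lborel. g y * g y) \<le> 0 + e" if "e > 0" for e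
  proof -
    interpret function_ring_on "exp_algebra :: ('a \<Rightarrow> real) set" "cball 0 M"
      by (rule function_ring_on_exp_algebra) simp
    \<comment> \<open>This accuracy makes the total error at most
      \<open>I * (e / (I + 1)) \<le> e\<close>, also when \<open>I = 0\<close>.\<close>
    have "e / (I + 1) > 0" "continuous_on (cball 0 M) g"
      using that I g(1) by (auto intro: continuous_on_subset)
    then obtain p where p: "p \<in> exp_algebra" "\<And>y. norm y \<le> M \<Longrightarrow> \<bar>g y - p y\<bar> < e / (I + 1)"
      using Stone_Weierstrass_basic by (metis mem_cball_0)
    have intp: "integrable lborel (\<lambda>y. g y * p y)"
      using p(1) exp_algebra_continuous by (intro int)
    have "(LINT y|lborel. g y * g y) = (LINT y|lborel. g y * g y - g y * p y)"
      using int[OF g(1)] intp exp_zero[OF p(1)] by simp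
    also have "\<dots> \<le> (LINT y|lborel. norm (g y) * (e / (I + 1)))"
    proof (rule integral_mono)
      show "g y * g y - g y * p y \<le> norm (g y) * (e / (I + 1))" for y
      proof (cases "g y = 0")
        case False
        have "g y * g y - g y * p y \<le> \<bar>g y\<bar> * \<bar>g y - p y\<bar>"
          by (metis abs_ge_self abs_mult right_diff_distrib)
        also have "\<dots> \<le> norm (g y) * (e / (I + 1))"
          unfolding real_norm_def using p(2)[OF g(2)[OF False]] by (intro mult_left_mono) auto
        finally show ?thesis .
      qed simp
    qed (use int[OF g(1)] intp int_g in auto)
    also have "\<dots> = I * (e / (I + 1))"
      by (simp add: I_def)
    also have "\<dots> \<le> e"
      using I that by (simp add: field_simps)
    finally show ?thesis by simp
  qed
  then have "(LINT y|lborel. g y * g y) \<le> 0"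
    by (rule field_le_epsilon)
  then have "(LINT y|lborel. g y * g y) = 0"
    by (intro antisym) auto
  then have "AE y in lborel. g y * g y = 0"
    using integral_nonneg_eq_0_iff_AE[OF int[OF g(1)]] by simp
  then have "AE y in lborel. \<not> g y \<noteq> 0"
    by simp
  \<comment> \<open>Continuity upgrades vanishing almost everywhere to vanishing everywhere: an open
    null set is empty.\<close>
  moreover have op: "open {y. g y \<noteq> 0}"
    using g(1) by (intro open_Collect_neq continuous_on_const)
  ultimately have "{y. g y \<noteq> 0} \<in> null_sets lborel"
    using AE_iff_null_sets[of "{y. g y \<noteq> 0}" lborel] by auto
  then have "negligible {y. g y \<noteq> 0}"
    by (simp add: negligible_iff_null_sets null_sets_completionI)
  then show ?thesis
    using open_not_negligible[OF op] by auto
qed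

section \<open>Injectivity from an interior point of N(D)\<close>

lemma zero_if_line_integrals_zero:
  fixes g :: "'a::euclidean_space \<Rightarrow> real"
  assumes g: "continuous_on UNIV g" "\<And>y. g y \<noteq> 0 \<Longrightarrow> norm y \<le> M"
    and D: "\<And>v. v \<in> D \<Longrightarrow> norm v = 1"
    and line: "\<And>v x. v \<in> D \<Longrightarrow> (LINT t|lborel. g (x + t *\<^sub>R v)) = 0"
    and N: "interior {x. \<exists>v\<in>D. x \<bullet> v = 0} \<noteq> {}"
  shows "g y = 0"
proof (rule zero_if_exp_integrals_zero[OF g])
  fix \<xi>
  show "(LINT y|lborel. g y * exp (y \<bullet> \<xi>)) = 0"
  proof (rule integral_exp_zero[OF g])
    fix k
    show "(LINT y|lborel. g y * (y \<bullet> \<xi>) ^ k) = 0"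
    proof (rule moments_zero_extend[OF g _ N])
      fix \<eta> assume "\<eta> \<in> {x. \<exists>v\<in>D. x \<bullet> v = 0}"
      then obtain v where "v \<in> D" "\<eta> \<bullet> v = 0"
        by blast
      then show "(LINT y|lborel. g y * (y \<bullet> \<eta>) ^ k) = 0"
        by (intro integral_ridge_zero[OF g, where \<phi> = "\<lambda>s. s ^ k" and v = v] D line continuous_intros)
    qed
  qed
qed

lemma C0_infty_continuous: "f \<in> C0_infty \<Longrightarrow> continuous_on UNIV f"
  unfolding C0_infty_def smooth_def by (metis (lifting) C_k.simps(1) mem_Collect_eq)

text \<open>Heine-Borel turns compact support into a radius \<open>M\<close>, the form in which the
  estimates use it.\<close>

lemma C0_infty_iff:
  "f \<in> C0_infty \<longleftrightarrow> smooth f \<and> (\<exists>M. \<forall>y. f y \<noteq> 0 \<longrightarrow> norm y \<le> M)"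
proof -
  have "compact (closure (support_on UNIV f)) \<longleftrightarrow> bounded (support_on UNIV f)"
    by (meson bounded_closure bounded_subset closed_closure closure_subset compact_eq_bounded_closed)
  then show ?thesis
    by (auto simp: C0_infty_def bounded_iff support_on_def)
qed

lemma xray_injective_if_interior:
  fixes D :: "(real ^ 'n) set"
  assumes D: "D \<subseteq> sphere 0 1" and N: "interior (normal_set D) \<noteq> {}"
  shows "xray_injective D"
  unfolding xray_injective_def
proof (intro ballI impI ext)
  fix f :: "real ^ 'n \<Rightarrow> complex" and y
  assume f: "f \<in> C0_infty" and zero: "\<forall>v\<in>D. \<forall>x. xray v f x = 0"
  note cont = C0_infty_continuous[OF f]
  obtain M where M: "\<And>y. f y \<noteq> 0 \<Longrightarrow> norm y \<le> M"
    using f by (auto simp: C0_infty_iff)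
  have int: "integrable lborel (\<lambda>t. f (x + t *\<^sub>R v))" if "v \<in> D" for x v
    using integrable_line[OF cont M] D that by auto
  \<comment> \<open>By integrability along lines, \<open>Re\<close> and \<open>Im\<close> commute
    with the integral, so both parts inherit the vanishing line integrals.\<close>
  have "Re (f y) = 0"
    by (rule zero_if_line_integrals_zero[where M = M and D = D])
      (use D N zero int in \<open>auto intro!: continuous_intros cont M simp: xray_def simp flip: normal_set_def\<close>)
  moreover have "Im (f y) = 0"
    by (rule zero_if_line_integrals_zero[where M = M and D = D])
      (use D N zero int in \<open>auto intro!: continuous_intros cont M simp: xray_def simp flip: normal_set_def\<close>)
  ultimately show "f y = 0"
    by (simp add: complex_eq_iff)
qed

section \<open>Geometric conditions for an interior point\<close>

lemma interior_normal_set_connected: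
  fixes D :: "(real ^ 'n) set"
  assumes D: "D \<subseteq> sphere 0 1" and C: "C \<subseteq> D" "connected C" "u \<in> C" "v \<in> C" "u \<noteq> v"
  shows "interior (normal_set D) \<noteq> {}"
proof -
  define U where "U = {x. x \<bullet> u < 0} \<inter> {x. x \<bullet> v > 0}"
  have "open U"
    unfolding U_def by (intro open_Int open_Collect_less continuous_intros)
  moreover have "U \<subseteq> normal_set D"
  proof
    fix x assume "x \<in> U"
    then have "x \<bullet> u < 0" "0 < x \<bullet> v"
      by (auto simp: U_def)
    moreover have "connected ((\<bullet>) x ` C)"
      by (intro connected_continuous_image C continuous_intros)
    ultimately have "0 \<in> (\<bullet>) x ` C"
      using connectedD_interval[of "(\<bullet>) x ` C" "x \<bullet> u" "x \<bullet> v" 0] C by auto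
    then show "x \<in> normal_set D"
      using C by (auto simp: normal_set_def)
  qed
  \<comment> \<open>For distinct unit vectors \<open>u \<bullet> v < 1\<close>, so
    \<open>v - u\<close> has inner product \<open>u \<bullet> v - 1 < 0\<close> with
    \<open>u\<close> and \<open>1 - u \<bullet> v > 0\<close> with \<open>v\<close>.\<close>
  moreover have "v - u \<in> U"
  proof -
    have [simp]: "u \<bullet> u = 1" "v \<bullet> v = 1"
      using C D by (auto simp: norm_eq_1 subset_iff)
    have "0 < (v - u) \<bullet> (v - u)"
      using C by simp
    then have "u \<bullet> v < 1"
      by (simp add: inner_diff_left inner_diff_right inner_commute[of v u])
    then show ?thesis
      by (simp add: U_def inner_diff_left inner_commute[of v u])
  qed
  ultimately show ?thesis
    using interior_maximal by blast
qed

text \<open>A great circle through a point of \<open>D\<close> stays in \<open>D\<close> for a short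
  time. The dimension bound supplies the orthogonal direction that spans the circle.\<close>

lemma openin_sphere_contains_arc:
  fixes D :: "'a::euclidean_space set"
  assumes D: "openin (top_of_set (sphere 0 1)) D" "D \<noteq> {}" and dim: "DIM('a) \<ge> 2"
  obtains C u v where "C \<subseteq> D" "connected C" "u \<in> C" "v \<in> C" "u \<noteq> v"
proof -
  obtain T where T: "open T" "D = sphere 0 1 \<inter> T"
    using D(1) by (auto simp: openin_open)
  obtain v where v: "v \<in> D"
    using D(2) by blast
  have nv: "v \<bullet> v = 1"
    using v T by (auto simp: norm_eq_1)
  obtain w where w: "w \<noteq> 0" "orthogonal v w"
    using orthogonal_to_vector_exists[OF dim] .
  define \<xi> where "\<xi> = sgn w"
  have \<xi>: "\<xi> \<bullet> \<xi> = 1" "v \<bullet> \<xi> = 0"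
    using w by (simp_all add: \<xi>_def orthogonal_def norm_sgn flip: norm_eq_1)
      (simp add: sgn_div_norm)
  define \<gamma> where "\<gamma> s = cos s *\<^sub>R v + sin s *\<^sub>R \<xi>" for s :: real
  have cont: "continuous_on S \<gamma>" for S
    unfolding \<gamma>_def by (intro continuous_intros)
  have sph: "\<gamma> s \<in> sphere 0 1" for s
    using sin_cos_squared_add[of s]
    by (simp add: \<gamma>_def norm_eq_1 inner_add_left inner_add_right nv \<xi> inner_commute[of \<xi> v] power2_eq_square)
  have "open (\<gamma> -` T)"
    using T(1) cont by (rule open_vimage)
  moreover have "0 \<in> \<gamma> -` T"
    using v T by (simp add: \<gamma>_def)
  ultimately obtain e where e: "e > 0" "cball 0 e \<subseteq> \<gamma> -` T"
    using open_contains_cball by blast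
  \<comment> \<open>Keeping \<open>s\<close> at most 1, hence below \<open>pi\<close>, makes
    \<open>sin s\<close> positive, so the end points of the arc differ.\<close>
  define s where "s = min e 1"
  have s: "0 < s" "s \<le> e" "s \<le> 1"
    using e by (auto simp: s_def)
  have "\<gamma> s \<noteq> \<gamma> 0"
  proof
    assume "\<gamma> s = \<gamma> 0"
    then have "\<gamma> s \<bullet> \<xi> = \<gamma> 0 \<bullet> \<xi>" by simp
    then have "sin s = 0"
      by (simp add: \<gamma>_def inner_add_left \<xi>)
    then show False
      using sin_gt_zero[of s] s pi_gt3 by simp
  qed
  moreover have "\<gamma> ` {0..s} \<subseteq> D"
    using e(2) s sph unfolding T(2) by (force simp: subset_iff)
  moreover have "connected (\<gamma> ` {0..s})"
    using cont by (rule connected_continuous_image) simp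
  ultimately show thesis
    using s by (intro that[of "\<gamma> ` {0..s}" "\<gamma> 0" "\<gamma> s"]) auto
qed

section \<open>A smooth bump function\<close>

text \<open>\<open>flat 0\<close> is the classical flat function. The powers of \<open>1 / t\<close>
  produced by differentiating it are built in, so the linear span of the family is closed under
  differentiation.\<close>

definition flat :: "nat \<Rightarrow> real \<Rightarrow> real" where
  "flat m t = (if t > 0 then exp (- 1 / t) / t ^ m else 0)"

lemma flat_tendsto_0: "(flat m \<longlongrightarrow> 0) (at_right 0)"
proof -
  \<comment> \<open>Substituting \<open>1 / t\<close>, this is the decay of a power divided by the
    exponential at infinity.\<close>
  have "((\<lambda>t. inverse t ^ m / exp (inverse t)) \<longlongrightarrow> (0::real)) (at_right 0)"
    using tendsto_power_div_exp_0 filterlim_inverse_at_top_right by (rule filterlim_compose)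
  moreover have "\<forall>\<^sub>F t in at_right 0. inverse t ^ m / exp (inverse t) = flat m t"
    by (auto simp: eventually_at_filter flat_def exp_minus field_simps)
  ultimately show ?thesis
    by (rule Lim_transform_eventually)
qed

lemma flat_has_derivative:
  "(flat m has_real_derivative flat (m + 2) t - m * flat (m + 1) t) (at t)"
proof -
  consider "t > 0" | "t < 0" | "t = 0" by linarith
  then show ?thesis
  proof cases
    case 1
    have pow: "((\<lambda>t. t ^ m) has_real_derivative m * t ^ m / t) (at t)"
      using DERIV_pow[of m t] 1 by (cases m) auto
    have exp: "((\<lambda>t. exp (- 1 / t)) has_real_derivative exp (- 1 / t) / t\<^sup>2) (at t)"
      using 1 by (auto intro!: derivative_eq_intros simp: power2_eq_square)
    have "((\<lambda>t. exp (- 1 / t) / t ^ m) has_real_derivative flat (m + 2) t - m * flat (m + 1) t) (at t)"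
      by (rule DERIV_cong[OF DERIV_quotient[OF exp pow]])
        (use 1 in \<open>simp_all add: flat_def field_simps power2_eq_square\<close>)
    then show ?thesis
      by (rule has_field_derivative_transform_within_open[where S = "{0<..}"])
        (use 1 in \<open>auto simp: flat_def\<close>)
  next
    case 2
    have "((\<lambda>t::real. 0::real) has_real_derivative flat (m + 2) t - m * flat (m + 1) t) (at t)"
      using 2 by (auto simp: flat_def)
    then show ?thesis
      by (rule has_field_derivative_transform_within_open[where S = "{..<0}"])
        (use 2 in \<open>auto simp: flat_def\<close>)
  next
    case 3
    have flat_at_0: "flat k 0 = 0" for k
      by (simp add: flat_def)
    \<comment> \<open>The difference quotient at 0 is the next member of the family, so its limit is
      already known.\<close>
    have quot: "(flat m h - flat m 0) / (h - 0) = flat (m + 1) h" for h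
      by (simp add: flat_def)
    have "(flat (m + 1) \<longlongrightarrow> 0) (at_left 0)"
      by (rule tendsto_eventually) (auto simp: eventually_at_filter flat_def)
    then have "(flat (m + 1) \<longlongrightarrow> 0) (at 0)"
      using flat_tendsto_0 by (rule filterlim_split_at)
    then show ?thesis
      unfolding 3 has_field_derivative_iff quot using flat_at_0 by simp
  qed
qed

text \<open>This class is closed under directional derivatives, so its members are smooth.\<close>

inductive_set flat_class :: "('a::euclidean_space \<Rightarrow> complex) set" where
  flat: "(\<lambda>x. of_real (flat m (1 - x \<bullet> x))) \<in> flat_class"
| inner: "f \<in> flat_class \<Longrightarrow> (\<lambda>x. of_real (x \<bullet> v) * f x) \<in> flat_class"
| scale: "f \<in> flat_class \<Longrightarrow> (\<lambda>x. c * f x) \<in> flat_class"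
| add: "f \<in> flat_class \<Longrightarrow> g \<in> flat_class \<Longrightarrow> (\<lambda>x. f x + g x) \<in> flat_class"

text \<open>The chain rule through \<open>1 - x \<bullet> x\<close> brings in the factor
  \<open>- 2 * (x \<bullet> v)\<close>, which is why the class admits multiplication by linear
  functions.\<close>

lemma flat_class_derivative:
  assumes "f \<in> flat_class"
  shows "\<exists>f'. (\<forall>x. (f has_derivative f' x) (at x)) \<and> (\<forall>v. (\<lambda>x. f' x v) \<in> flat_class)"
  using assms
proof induction
  case (flat m)
  define f' where "f' x v = complex_of_real ((flat (m + 2) (1 - x \<bullet> x) - m * flat (m + 1) (1 - x \<bullet> x)) *
    (- (2 * (x \<bullet> v))))" for x v :: 'a
  have "((\<lambda>x. complex_of_real (flat m (1 - x \<bullet> x))) has_derivative f' x) (at x)" for x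
  proof -
    have "((\<lambda>x. 1 - x \<bullet> x) has_derivative (\<lambda>v. - (2 * (x \<bullet> v)))) (at x)"
      by (auto intro!: derivative_eq_intros simp: inner_commute)
    moreover have "(flat m has_derivative (\<lambda>s. (flat (m + 2) (1 - x \<bullet> x) - m * flat (m + 1) (1 - x \<bullet> x)) * s))
        (at (1 - x \<bullet> x))"
      using flat_has_derivative[of m "1 - x \<bullet> x"] by (simp add: has_field_derivative_def)
    ultimately have "((\<lambda>x. flat m (1 - x \<bullet> x)) has_derivative
        (\<lambda>v. (flat (m + 2) (1 - x \<bullet> x) - m * flat (m + 1) (1 - x \<bullet> x)) * (- (2 * (x \<bullet> v))))) (at x)"
      by (rule has_derivative_compose)
    then show ?thesis
      unfolding f'_def by (rule has_derivative_of_real)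
  qed
  moreover have "(\<lambda>x. f' x v) \<in> flat_class" for v
  proof -
    have "(\<lambda>x. f' x v) = (\<lambda>x. - 2 * (of_real (x \<bullet> v) *
        (of_real (flat (m + 2) (1 - x \<bullet> x)) + (- of_nat m) * of_real (flat (m + 1) (1 - x \<bullet> x)))))"
      by (simp add: f'_def algebra_simps)
    also have "\<dots> \<in> flat_class"
      by (intro flat_class.intros)
    finally show ?thesis .
  qed
  ultimately show ?case by blast
next
  case (inner f w)
  then obtain f' where f': "\<And>x. (f has_derivative f' x) (at x)" "\<And>v. (\<lambda>x. f' x v) \<in> flat_class"
    by blast
  have "((\<lambda>x. of_real (x \<bullet> w) * f x) has_derivative (\<lambda>v. of_real (x \<bullet> w) * f' x v + of_real (v \<bullet> w) * f x)) (at x)" for x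
    by (auto intro!: derivative_eq_intros f')
  moreover have "(\<lambda>x. of_real (x \<bullet> w) * f' x v + of_real (v \<bullet> w) * f x) \<in> flat_class" for v
    using f' inner by (intro flat_class.intros)
  ultimately show ?case
    by (intro exI[of _ "\<lambda>x v. of_real (x \<bullet> w) * f' x v + of_real (v \<bullet> w) * f x"]) blast
next
  case (scale f c)
  then obtain f' where f': "\<And>x. (f has_derivative f' x) (at x)" "\<And>v. (\<lambda>x. f' x v) \<in> flat_class"
    by blast
  have "((\<lambda>x. c * f x) has_derivative (\<lambda>v. c * f' x v)) (at x)" for x
    by (auto intro!: derivative_eq_intros f')
  then show ?case
    using f' by (intro exI[of _ "\<lambda>x v. c * f' x v"]) (auto intro: flat_class.intros)
next
  case (add f g)
  then obtain f' g' where f': "\<And>x. (f has_derivative f' x) (at x)" "\<And>v. (\<lambda>x. f' x v) \<in> flat_class"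
    and g': "\<And>x. (g has_derivative g' x) (at x)" "\<And>v. (\<lambda>x. g' x v) \<in> flat_class"
    by blast
  have "((\<lambda>x. f x + g x) has_derivative (\<lambda>v. f' x v + g' x v)) (at x)" for x
    by (auto intro!: derivative_eq_intros f' g')
  then show ?case
    using f' g' by (intro exI[of _ "\<lambda>x v. f' x v + g' x v"]) (auto intro: flat_class.intros)
qed

lemma C_k_flat_class: "f \<in> flat_class \<Longrightarrow> C_k k f"
proof (induction k arbitrary: f)
  case 0
  then show ?case
    using flat_class_derivative[of f]
    by (auto simp: continuous_on_eq_continuous_at intro: has_derivative_continuous)
next
  case (Suc k)
  obtain f' where f': "\<And>x. (f has_derivative f' x) (at x)" "\<And>v. (\<lambda>x. f' x v) \<in> flat_class"
    using flat_class_derivative[OF Suc.prems] by blast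
  have "frechet_derivative f (at x) = f' x" for x
    using frechet_derivative_at[OF f'(1)] by simp
  then show ?case
    using f' Suc.IH by (auto simp: differentiable_def)
qed

section \<open>Kernel elements by differencing, for finite D\<close>

lemma C_k_translate: "C_k k f \<Longrightarrow> C_k k (\<lambda>x. f (x + w))"
proof (induction k arbitrary: f)
  case 0
  then show ?case
    by (auto intro!: continuous_on_compose2[of UNIV f] continuous_intros)
next
  case (Suc k)
  have d: "((\<lambda>x. f (x + w)) has_derivative frechet_derivative f (at (x + w))) (at x)" for x
  proof -
    have "(f has_derivative frechet_derivative f (at (x + w))) (at (x + w))"
      using Suc.prems by (simp flip: frechet_derivative_works)
    moreover have "((\<lambda>x. x + w) has_derivative (\<lambda>v. v)) (at x)"
      by (auto intro!: derivative_eq_intros)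
    ultimately show ?thesis
      using has_derivative_compose by fastforce
  qed
  have "frechet_derivative (\<lambda>x. f (x + w)) (at x) = frechet_derivative f (at (x + w))" for x
    using frechet_derivative_at[OF d] by simp
  moreover have "C_k k (\<lambda>x. frechet_derivative f (at (x + w)) v)" for v
    using Suc.prems by (intro Suc.IH[of "\<lambda>x. frechet_derivative f (at x) v"]) simp
  ultimately show ?case
    using d by (auto simp: differentiable_def)
qed

lemma C_k_diff: "C_k k f \<Longrightarrow> C_k k g \<Longrightarrow> C_k k (\<lambda>x. f x - g x)"
proof (induction k arbitrary: f g)
  case 0
  then show ?case
    by (auto intro!: continuous_intros)
next
  case (Suc k)
  have d: "((\<lambda>x. f x - g x) has_derivative
      (\<lambda>v. frechet_derivative f (at x) v - frechet_derivative g (at x) v)) (at x)" for x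
    using Suc.prems by (auto intro!: has_derivative_diff simp flip: frechet_derivative_works)
  have "frechet_derivative (\<lambda>x. f x - g x) (at x) =
      (\<lambda>v. frechet_derivative f (at x) v - frechet_derivative g (at x) v)" for x
    using frechet_derivative_at[OF d] by simp
  moreover have "(\<lambda>x. f x - g x) differentiable (at x)" for x
    using d unfolding differentiable_def by blast
  ultimately show ?case
    using Suc by simp
qed

lemma C0_infty_bump: "(\<lambda>x. of_real (flat 0 (1 - x \<bullet> x))) \<in> C0_infty"
  unfolding C0_infty_iff
proof (intro conjI exI allI impI)
  show "smooth (\<lambda>x::real ^ 'n. complex_of_real (flat 0 (1 - x \<bullet> x)))"
    unfolding smooth_def by (auto intro: C_k_flat_class flat_class.flat)
  show "norm y \<le> 1" if "complex_of_real (flat 0 (1 - y \<bullet> y)) \<noteq> 0" for y :: "real ^ 'n"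
    using that by (auto simp: flat_def norm_le_square split: if_splits)
qed

lemma C0_infty_difference:
  assumes "f \<in> C0_infty"
  shows "(\<lambda>x. f (x + w) - f x) \<in> C0_infty"
proof -
  obtain M where M: "\<And>y. f y \<noteq> 0 \<Longrightarrow> norm y \<le> M"
    using assms by (auto simp: C0_infty_iff)
  have "norm y \<le> M + norm w" if "f (y + w) - f y \<noteq> 0" for y
  proof (cases "f y = 0")
    case True
    then show ?thesis
      using that M[of "y + w"] norm_triangle_ineq2[of y "- w"] by simp
  next
    case False
    then show ?thesis
      using M[of y] norm_ge_zero[of w] by linarith
  qed
  moreover have "smooth (\<lambda>x. f (x + w) - f x)"
    using assms by (auto simp: smooth_def C0_infty_iff intro!: C_k_diff C_k_translate)
  ultimately show ?thesis
    by (auto simp: C0_infty_iff)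
qed

text \<open>A nonzero value would repeat at all \<open>x + of_nat k *\<^sub>R v\<close>, and these
  points leave every ball.\<close>

lemma periodic_bounded_support_zero:
  fixes f :: "'a::real_normed_vector \<Rightarrow> 'b::zero"
  assumes per: "\<And>x. f (x + v) = f x" and v: "v \<noteq> 0" and M: "\<And>y. f y \<noteq> 0 \<Longrightarrow> norm y \<le> M"
  shows "f x = 0"
proof (rule ccontr)
  assume nz: "f x \<noteq> 0"
  have "f (x + of_nat k *\<^sub>R v) = f x" for k
  proof (induction k)
    case (Suc k)
    then show ?case
      using per[of "x + of_nat k *\<^sub>R v"] by (simp add: algebra_simps)
  qed simp
  then have *: "norm (x + of_nat k *\<^sub>R v) \<le> M" for k
    using M nz by metis
  obtain k where "M + norm x < of_nat k * norm v"
    using reals_Archimedean3[of "norm v"] v by auto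
  then show False
    using *[of k] norm_triangle_ineq2[of "of_nat k *\<^sub>R v" "- x"] by (simp add: add.commute)
qed

lemma xray_difference:
  assumes f: "f \<in> C0_infty" and v: "norm v = 1"
  shows "xray v (\<lambda>x. f (x + w) - f x) x = xray v f (x + w) - xray v f x"
proof -
  obtain M where "\<And>y. f y \<noteq> 0 \<Longrightarrow> norm y \<le> M"
    using f by (auto simp: C0_infty_iff)
  then have int: "integrable lborel (\<lambda>t. f (x + t *\<^sub>R v))" for x
    using integrable_line C0_infty_continuous[OF f] v by blast
  have "xray v (\<lambda>x. f (x + w) - f x) x = (LINT t|lborel. f ((x + w) + t *\<^sub>R v) - f (x + t *\<^sub>R v))"
    by (simp add: xray_def add_ac)
  also have "\<dots> = xray v f (x + w) - xray v f x"
    unfolding xray_def by (rule Bochner_Integration.integral_diff[OF int int])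
  finally show ?thesis .
qed

text \<open>Moving the base point by \<open>v\<close> only shifts the parameter of the same line by
  1.\<close>

lemma xray_translate_direction:
  "xray v f (x + v) = xray v f x"
  using lborel_integral_real_affine[of 1 "\<lambda>t. f (x + t *\<^sub>R v)" 1]
  by (simp add: xray_def algebra_simps)

lemma not_xray_injective_finite:
  fixes D :: "(real ^ 'n) set"
  assumes "finite D" "D \<subseteq> sphere 0 1"
  shows "\<not> xray_injective D"
proof -
  have "\<exists>f::real ^ 'n \<Rightarrow> complex. f \<in> C0_infty \<and> (\<exists>x. f x \<noteq> 0) \<and> (\<forall>v\<in>D. \<forall>x. xray v f x = 0)"
    using assms
  proof (induction D)
    case empty
    have "complex_of_real (flat 0 (1 - 0 \<bullet> (0::real ^ 'n))) \<noteq> 0"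
      by (simp add: flat_def)
    then show ?case
      using C0_infty_bump by blast
  next
    case (insert w D)
    then obtain f :: "real ^ 'n \<Rightarrow> complex" and x0 where f: "f \<in> C0_infty" "f x0 \<noteq> 0"
      and zero: "\<And>v x. v \<in> D \<Longrightarrow> xray v f x = 0"
      by auto
    define g where "g = (\<lambda>x. f (x + w) - f x)"
    have unit: "norm v = 1" if "v \<in> insert w D" for v
      using that insert.prems by auto
    have "g \<in> C0_infty"
      unfolding g_def using f(1) by (rule C0_infty_difference)
    moreover have "\<exists>x. g x \<noteq> 0"
    proof (rule ccontr)
      assume "\<not> (\<exists>x. g x \<noteq> 0)"
      then have "f (x + w) = f x" for x
        by (simp add: g_def)
      moreover obtain M where "\<And>y. f y \<noteq> 0 \<Longrightarrow> norm y \<le> M"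
        using f(1) by (auto simp: C0_infty_iff)
      moreover have "w \<noteq> 0"
        using unit[of w] by auto
      ultimately show False
        using periodic_bounded_support_zero f(2) by blast
    qed
    \<comment> \<open>Differencing in direction \<open>w\<close> kills the transform along
      \<open>w\<close> by translation invariance; along the directions already in \<open>D\<close>,
      both terms vanish by induction.\<close>
    moreover have "xray v g x = 0" if "v \<in> insert w D" for v x
      using that zero xray_translate_direction[of w f]
      by (auto simp: g_def xray_difference[OF f(1) unit])
    ultimately show ?case by blast
  qed
  then show ?thesis
    unfolding xray_injective_def by (metis (no_types, lifting))
qed

text \<open>For n = 1 the sphere has just two points, so a nonempty open \<open>D\<close> is finite
  and the transform is not injective; hence \<open>CARD('n) \<ge> 2\<close> in the case of open
  \<open>D\<close>.\<close>

theorem corollary6: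
  fixes D :: "(real ^ 'n) set"
  assumes "D \<subseteq> sphere 0 1"
  shows "(finite D \<longrightarrow> \<not> xray_injective D) \<and>
    (interior (normal_set D) \<noteq> {} \<longrightarrow> xray_injective D) \<and>
    (CARD('n) \<ge> 2 \<and> D \<noteq> {} \<and> openin (top_of_set (sphere 0 1)) D \<longrightarrow> xray_injective D) \<and>
    ((\<exists>C. C \<subseteq> D \<and> connected C \<and> (\<exists>u\<in>C. \<exists>v\<in>C. u \<noteq> v)) \<longrightarrow> xray_injective D)"
proof (intro conjI impI)
  assume "finite D"
  then show "\<not> xray_injective D"
    using assms by (rule not_xray_injective_finite)
next
  assume "interior (normal_set D) \<noteq> {}"
  with assms show "xray_injective D"
    by (rule xray_injective_if_interior)
next
  assume "CARD('n) \<ge> 2 \<and> D \<noteq> {} \<and> openin (top_of_set (sphere 0 1)) D"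
  then obtain C u v where "C \<subseteq> D" "connected C" "u \<in> C" "v \<in> C" "u \<noteq> v"
    using openin_sphere_contains_arc[of D] by auto
  then show "xray_injective D"
    using assms interior_normal_set_connected xray_injective_if_interior by metis
next
  assume "\<exists>C. C \<subseteq> D \<and> connected C \<and> (\<exists>u\<in>C. \<exists>v\<in>C. u \<noteq> v)"
  then show "xray_injective D"
    using assms interior_normal_set_connected xray_injective_if_interior by metis
qed

end
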